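(* Let $n\in\mathbb{N}$ be odd. Then every (maximal) solution $t\mapsto q(t)\in\mathbb{R}$ of the Lane-Emden equation $$\ddot q=-q^n-\frac{2}{t}\,\dot q,\qquad t>0,$$ is defined for all $t\in(0,+\infty)$. If moreover $n\ge 5$, then for every solution $q$ there exist constants $c_3,c_4$ such that, for all sufficiently large $t$, $$|q(t)|\le\frac{c_3}{t^{1/(n+1)}},\qquad |\dot q(t)|\le\frac{c_4}{\sqrt{t}}.$$
   Context: The unknown $q$ is real-valued, the independent variable $t$ ranges in $(0,+\infty)$, and dots denote derivatives with respect to $t$. "Solution" means a solution of the ODE (with Cauchy initial data $q(t_0),\dot q(t_0)$ prescribed at some $t_0>0$) on its maximal interval of existence inside $(0,+\infty)$. The constants $c_3,c_4$ may depend on the solution. *)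

theory Defs
  imports "HOL-Analysis.Analysis"
begin

text \<open>
  A solution consists of the function together with its interval of existence; the values of the
  function outside the interval are irrelevant. As the interval is open, the two-sided derivatives
  below depend only on the values inside it.
\<close>

definition lane_emden_solution :: "nat \<Rightarrow> (real \<Rightarrow> real) \<Rightarrow> real set \<Rightarrow> bool" where
  "lane_emden_solution n q I \<longleftrightarrow>
     open I \<and> is_interval I \<and> I \<noteq> {} \<and> I \<subseteq> {0<..} \<and>
     (\<forall>t\<in>I. (q has_real_derivative deriv q t) (at t) \<and>
            (deriv q has_real_derivative (- (q t ^ n) - 2 / t * deriv q t)) (at t))"

definition maximal_lane_emden_solution :: "nat \<Rightarrow> (real \<Rightarrow> real) \<Rightarrow> real set \<Rightarrow> bool" where
  "maximal_lane_emden_solution n q I \<longleftrightarrow>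
     lane_emden_solution n q I \<and>
     (\<forall>p J. lane_emden_solution n p J \<and> I \<subseteq> J \<and> (\<forall>t\<in>I. p t = q t) \<longrightarrow> J = I)"

end

theory Submission
  imports Defs
begin

text \<open>
  Let $E = \dot q^2/2 + q^{n+1}/(n+1)$, which is nonnegative as $n$ is odd. From
  $\dot E = -2\dot q^2/t$ one sees that $E$ is nonincreasing and $t^4 E$ is nondecreasing, so $q$ and
  $\dot q$ stay bounded as long as $t$ stays away from $0$. The time for which the Picard iteration
  continues a solution from $s$ is then bounded below for all $s$ near a given positive time, hence
  the domain of a maximal solution is closed in $(0,\infty)$.

  For the decay, $G = tE + q\dot q + q^2/t$ has derivative
  $-\dot q^2/2 - \frac{n}{n+1} q^{n+1} - q^2/t^2 \le 0$. Completing the square gives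
  $G \ge t\dot q^2/4 + t q^{n+1}/(n+1)$, so both terms on the right are bounded for $t \ge 1$.
\<close>

section \<open>Picard-Lindeloef theorem in Banach spaces\<close>

lemma vector_derivative_bound:
  fixes g :: "real \<Rightarrow> 'a::real_normed_vector"
  assumes "convex S"
    and der: "\<And>u. u \<in> S \<Longrightarrow> (g has_vector_derivative g' u) (at u within S)"
    and bnd: "\<And>u. u \<in> S \<Longrightarrow> norm (g' u) \<le> B"
    and "u \<in> S" "v \<in> S"
  shows "norm (g u - g v) \<le> B * \<bar>u - v\<bar>"
proof -
  have "norm (g u - g v) \<le> B * norm (u - v)"
  proof (rule differentiable_bound[OF \<open>convex S\<close> _ _ \<open>u \<in> S\<close> \<open>v \<in> S\<close>])
    fix w assume w: "w \<in> S"
    show "(g has_derivative (\<lambda>h. h *\<^sub>R g' w)) (at w within S)"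
      using der[OF w] by (simp add: has_vector_derivative_def)
    show "onorm (\<lambda>h. h *\<^sub>R g' w) \<le> B"
      using bnd[OF w] by (auto simp: mult.commute[of B] intro!: onorm_le mult_left_mono)
  qed
  then show ?thesis by simp
qed

text \<open>Banach's fixed point theorem for the integral operator in the sup metric. The condition
  \<open>\<delta> * B \<le> r\<close> keeps the operator inside the ball, and
  \<open>\<delta> * L < 1\<close> makes it a contraction.\<close>

theorem Picard_Lindeloef:
  fixes f :: "real \<Rightarrow> 'a::banach \<Rightarrow> 'a"
  assumes "\<delta> > 0" "L \<ge> 0"
    and cont: "continuous_on ({t0 - \<delta>..t0 + \<delta>} \<times> cball x0 r) (\<lambda>(t, x). f t x)"
    and bnd: "\<And>t x. t \<in> {t0 - \<delta>..t0 + \<delta>} \<Longrightarrow> x \<in> cball x0 r \<Longrightarrow> norm (f t x) \<le> B"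
    and lip: "\<And>t x y. t \<in> {t0 - \<delta>..t0 + \<delta>} \<Longrightarrow> x \<in> cball x0 r \<Longrightarrow> y \<in> cball x0 r \<Longrightarrow>
                norm (f t x - f t y) \<le> L * norm (x - y)"
    and "0 \<le> B" "\<delta> * B \<le> r" "\<delta> * L < 1"
  obtains x where "x t0 = x0"
    "\<And>t. t \<in> {t0 - \<delta><..<t0 + \<delta>} \<Longrightarrow> (x has_vector_derivative f t (x t)) (at t)"
proof -
  define I where "I = {t0 - \<delta>..t0 + \<delta>}"
  \<comment> \<open>Clamping time to \<open>I\<close> turns a function on \<open>I\<close> into a
    bounded continuous function on the whole line, so that the complete space of such functions can
    be used.\<close>
  define c where "c = (\<lambda>t. max (t0 - \<delta>) (min (t0 + \<delta>) t))"
  define F where "F = (\<lambda>y s. f s (y s))"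
  \<comment> \<open>The integral from \<open>t0\<close> to \<open>u\<close>, written as a difference
    of integrals from the left endpoint so that it also has the right sign for
    \<open>u < t0\<close>.\<close>
  define P where "P = (\<lambda>y u. x0 + (integral {t0 - \<delta>..u} (F y) - integral {t0 - \<delta>..t0} (F y)))"
  define S where "S = PiC (UNIV::real set) (\<lambda>_. cball x0 r)"
  define T where "T = (\<lambda>y::real \<Rightarrow>\<^sub>C 'a. Bcontfun (\<lambda>t. P y (c t)))"
  have "0 \<le> r"
    using \<open>\<delta> > 0\<close> \<open>0 \<le> B\<close> \<open>\<delta> * B \<le> r\<close> by (meson mult_nonneg_nonneg less_imp_le order_trans)
  have cI: "c t \<in> I" for t
    using \<open>\<delta> > 0\<close> by (auto simp: c_def I_def)
  have cid: "c t = t" if "t \<in> I" for t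
    using that by (auto simp: c_def I_def)
  have t0I: "t0 \<in> I"
    using \<open>\<delta> > 0\<close> by (auto simp: I_def)
  have near: "\<bar>u - t0\<bar> \<le> \<delta>" if "u \<in> I" for u
    using that by (auto simp: I_def)
  have conv: "convex I"
    by (simp add: I_def)
  have ccont: "continuous_on UNIV c"
    unfolding c_def by (intro continuous_intros)
  have SD: "apply_bcontfun y t \<in> cball x0 r" if "y \<in> S" for y t
    using that unfolding S_def mem_PiC_iff by blast
  have Fcont: "continuous_on I (F y)" if "y \<in> S" for y :: "real \<Rightarrow>\<^sub>C 'a"
  proof -
    have "continuous_on I (\<lambda>s. (s, y s))"
      by (intro continuous_intros continuous_on_apply_bcontfun)
    then have "continuous_on I (\<lambda>s. (\<lambda>(t, x). f t x) (s, y s))"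
      using SD[OF that] by (intro continuous_on_compose2[OF cont]) (auto simp: I_def)
    then show ?thesis
      by (simp add: F_def)
  qed
  have Pder: "(P y has_vector_derivative F y u) (at u within I)" if "y \<in> S" "u \<in> I"
    for y :: "real \<Rightarrow>\<^sub>C 'a" and u
    unfolding P_def using integral_has_vector_derivative[OF Fcont[OF that(1), unfolded I_def]] that(2)
    by (auto intro!: derivative_eq_intros simp: I_def)
  have PI: "P y u \<in> cball x0 r" if "y \<in> S" "u \<in> I" for y :: "real \<Rightarrow>\<^sub>C 'a" and u
  proof -
    have "norm (P y u - P y t0) \<le> B * \<bar>u - t0\<bar>"
      using Pder[OF that(1)] SD[OF that(1)] that(2) t0I
      by (intro vector_derivative_bound[OF conv]) (auto simp: F_def I_def intro!: bnd)
    also have "\<dots> \<le> B * \<delta>"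
      using near[OF that(2)] \<open>0 \<le> B\<close> by (intro mult_left_mono)
    also have "\<dots> \<le> r"
      using \<open>\<delta> * B \<le> r\<close> by (simp add: mult.commute)
    finally show ?thesis
      by (simp add: P_def dist_norm norm_minus_commute)
  qed
  have TS: "apply_bcontfun (T y) = (\<lambda>t. P y (c t))" if "y \<in> S" for y
  proof -
    have "continuous_on I (P y)"
      using has_vector_derivative_continuous[OF Pder[OF that]]
      by (simp add: continuous_on_eq_continuous_within)
    then have "continuous_on UNIV (\<lambda>t. P y (c t))"
      using cI by (intro continuous_on_compose2[OF _ ccont]) auto
    moreover have "bounded (range (\<lambda>t. P y (c t)))"
      using PI[OF that cI] by (intro bounded_subset[OF bounded_cball[of x0 r]]) auto
    ultimately show ?thesis
      unfolding T_def by (intro Bcontfun_inverse) (simp add: bcontfun_def)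
  qed
  have "\<exists>!y\<in>S. T y = y"
  proof (rule Banach_fix)
    show "complete S"
      unfolding S_def complete_eq_closed by (rule closed_PiC) auto
    show "S \<noteq> {}"
    proof -
      have "const_bcontfun x0 \<in> S"
        using \<open>0 \<le> r\<close> by (simp add: S_def mem_PiC_iff const_bcontfun.rep_eq)
      then show ?thesis by blast
    qed
    show "0 \<le> \<delta> * L" "\<delta> * L < 1"
      using assms by auto
    show "T ` S \<subseteq> S"
      using PI cI by (auto simp: S_def mem_PiC_iff TS[unfolded S_def])
    show "dist (T y) (T z) \<le> \<delta> * L * dist y z" if y: "y \<in> S" and z: "z \<in> S" for y z
    proof (rule dist_bound)
      fix t
      \<comment> \<open>The subtracted difference at \<open>t0\<close> vanishes, since both
        functions take the value \<open>x0\<close> there. The mean value inequality over a time of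
        at most \<open>\<delta>\<close> then gives the factor \<open>\<delta> * L\<close>.\<close>
      have "norm ((P y (c t) - P z (c t)) - (P y t0 - P z t0)) \<le> (L * dist y z) * \<bar>c t - t0\<bar>"
      proof (rule vector_derivative_bound[OF conv _ _ cI t0I])
        fix u assume u: "u \<in> I"
        show "((\<lambda>s. P y s - P z s) has_vector_derivative (F y u - F z u)) (at u within I)"
          by (intro has_vector_derivative_diff Pder y z u)
        have "norm (F y u - F z u) \<le> L * norm (y u - z u)"
          unfolding F_def using u SD[OF y] SD[OF z] by (intro lip) (auto simp: I_def)
        also have "\<dots> \<le> L * dist y z"
          using dist_bounded[of y u z] \<open>L \<ge> 0\<close> by (intro mult_left_mono) (auto simp: dist_norm)
        finally show "norm (F y u - F z u) \<le> L * dist y z" .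
      qed
      also have "\<dots> \<le> (L * dist y z) * \<delta>"
        using near[OF cI] \<open>L \<ge> 0\<close> by (intro mult_left_mono) auto
      finally show "dist (T y t) (T z t) \<le> \<delta> * L * dist y z"
        by (simp add: TS y z P_def dist_norm mult_ac)
    qed
  qed
  then obtain y where y: "y \<in> S" "T y = y"
    by blast
  then have fixed: "apply_bcontfun y t = P y (c t)" for t
    using TS by metis
  show thesis
  proof
    show "y t0 = x0"
      using fixed[of t0] by (simp add: cid t0I P_def)
    fix t assume t: "t \<in> {t0 - \<delta><..<t0 + \<delta>}"
    then have "t \<in> I"
      by (auto simp: I_def)
    have "(P y has_vector_derivative f t (y t)) (at t within I)"
      using Pder[OF y(1) \<open>t \<in> I\<close>] by (simp add: F_def)
    then have "(P y has_vector_derivative f t (y t)) (at t)"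
      using t at_within_interior[of t I] by (simp add: I_def interior_atLeastAtMost_real)
    then show "(y has_vector_derivative f t (y t)) (at t)"
      by (rule has_vector_derivative_transform_within_open[where S = "{t0 - \<delta><..<t0 + \<delta>}"])
         (use t in \<open>auto simp: fixed cid I_def\<close>)
  qed
qed

text \<open>Gronwall's argument in both time directions: \<open>w t * exp (- C * t)\<close> is
  nonincreasing and \<open>w t * exp (C * t)\<close> is nondecreasing, so a nonnegative
  \<open>w\<close> that vanishes at \<open>s\<close> vanishes on either side of it.\<close>

lemma gronwall_zero:
  fixes w :: "real \<Rightarrow> real"
  assumes der: "\<And>t. t \<in> {a..b} \<Longrightarrow> (w has_real_derivative w' t) (at t)"
    and bnd: "\<And>t. t \<in> {a..b} \<Longrightarrow> \<bar>w' t\<bar> \<le> C * w t"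
    and nn: "\<And>t. 0 \<le> w t"
    and s: "s \<in> {a..b}" "w s = 0" and t: "t \<in> {a..b}"
  shows "w t = 0"
proof (cases "s \<le> t")
  case True
  have "w t * exp (- C * t) \<le> w s * exp (- C * s)"
  proof (rule DERIV_nonpos_imp_nonincreasing[OF True])
    fix x assume "s \<le> x" "x \<le> t"
    then have x: "x \<in> {a..b}"
      using s t by auto
    have "((\<lambda>t. w t * exp (- C * t)) has_real_derivative (w' x - C * w x) * exp (- C * x)) (at x)"
      using der[OF x] by (auto intro!: derivative_eq_intros simp: algebra_simps)
    moreover have "(w' x - C * w x) * exp (- C * x) \<le> 0"
      using bnd[OF x] by (intro mult_nonpos_nonneg) auto
    ultimately show "\<exists>y. ((\<lambda>t. w t * exp (- C * t)) has_real_derivative y) (at x) \<and> y \<le> 0"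
      by blast
  qed
  then show ?thesis
    using s nn[of t] by (simp add: mult_le_0_iff)
next
  case False
  then have "t \<le> s" by simp
  have "w t * exp (C * t) \<le> w s * exp (C * s)"
  proof (rule DERIV_nonneg_imp_nondecreasing[OF \<open>t \<le> s\<close>])
    fix x assume "t \<le> x" "x \<le> s"
    then have x: "x \<in> {a..b}"
      using s t by auto
    have "((\<lambda>t. w t * exp (C * t)) has_real_derivative (w' x + C * w x) * exp (C * x)) (at x)"
      using der[OF x] by (auto intro!: derivative_eq_intros simp: algebra_simps)
    moreover have "(w' x + C * w x) * exp (C * x) \<ge> 0"
      using bnd[OF x] by (intro mult_nonneg_nonneg) auto
    ultimately show "\<exists>y. ((\<lambda>t. w t * exp (C * t)) has_real_derivative y) (at x) \<and> 0 \<le> y"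
      by blast
  qed
  then show ?thesis
    using s nn[of t] by (simp add: mult_le_0_iff)
qed

text \<open>By Cauchy-Schwarz the squared distance of the two solutions changes at a rate of at most
  \<open>2 * L\<close> times itself; the inner product makes that square differentiable even where
  the solutions meet. The Lipschitz estimate is asked for only along the two solutions, so a locally
  Lipschitz field qualifies.\<close>

lemma ode_unique:
  fixes x y :: "real \<Rightarrow> 'a::real_inner"
  assumes x: "\<And>t. t \<in> {a..b} \<Longrightarrow> (x has_vector_derivative f t (x t)) (at t)"
    and y: "\<And>t. t \<in> {a..b} \<Longrightarrow> (y has_vector_derivative f t (y t)) (at t)"
    and lip: "\<And>t. t \<in> {a..b} \<Longrightarrow> norm (f t (x t) - f t (y t)) \<le> L * norm (x t - y t)"
    and "s \<in> {a..b}" "x s = y s" "t \<in> {a..b}"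
  shows "x t = y t"
proof -
  let ?d = "\<lambda>t. x t - y t" and ?g = "\<lambda>t. f t (x t) - f t (y t)"
  have "?d t \<bullet> ?d t = 0"
  proof (rule gronwall_zero[where w = "\<lambda>t. ?d t \<bullet> ?d t" and C = "2 * L" and t = t and w' = "\<lambda>t. 2 * (?d t \<bullet> ?g t)"])
    fix t assume t: "t \<in> {a..b}"
    have d: "(?d has_derivative (\<lambda>h. h *\<^sub>R ?g t)) (at t)"
      using has_vector_derivative_diff[OF x[OF t] y[OF t]] by (simp add: has_vector_derivative_def)
    show "((\<lambda>t. ?d t \<bullet> ?d t) has_real_derivative 2 * (?d t \<bullet> ?g t)) (at t)"
      unfolding has_field_derivative_def
      by (rule has_derivative_eq_rhs[OF has_derivative_inner[OF d d]])
         (auto simp: inner_commute algebra_simps)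
    have "\<bar>?d t \<bullet> ?g t\<bar> \<le> norm (?d t) * norm (?g t)"
      by (rule Cauchy_Schwarz_ineq2)
    also have "\<dots> \<le> norm (?d t) * (L * norm (?d t))"
      using lip[OF t] by (intro mult_left_mono) auto
    also have "\<dots> = L * (?d t \<bullet> ?d t)"
      by (simp add: dot_square_norm power2_eq_square)
    finally show "\<bar>2 * (?d t \<bullet> ?g t)\<bar> \<le> 2 * L * (?d t \<bullet> ?d t)"
      by simp
  qed (use assms in auto)
  then show ?thesis by simp
qed


section \<open>The equation as a first-order system in position and velocity\<close>

definition lane_emden_field :: "nat \<Rightarrow> real \<Rightarrow> real \<times> real \<Rightarrow> real \<times> real" where
  "lane_emden_field n t x = (snd x, - (fst x ^ n) - 2 / t * snd x)"

text \<open>Mean value theorem on \<open>{-R..R}\<close>, where \<open>R ^ (n - 1)\<close> dominates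
  the power in the derivative.\<close>

lemma power_diff_le:
  fixes x y R :: real
  assumes "\<bar>x\<bar> \<le> R" "\<bar>y\<bar> \<le> R"
  shows "\<bar>x ^ n - y ^ n\<bar> \<le> real n * R ^ (n - 1) * \<bar>x - y\<bar>"
proof -
  have "norm (x ^ n - y ^ n) \<le> (real n * R ^ (n - 1)) * norm (x - y)"
  proof (rule field_differentiable_bound[where S = "{-R..R}"])
    fix z assume z: "z \<in> {-R..R}"
    show "((\<lambda>z. z ^ n) has_field_derivative real n * z ^ (n - 1)) (at z within {-R..R})"
      by (auto intro!: derivative_eq_intros)
    have "\<bar>z\<bar> ^ (n - 1) \<le> R ^ (n - 1)"
      using z by (intro power_mono) auto
    then show "norm (real n * z ^ (n - 1)) \<le> real n * R ^ (n - 1)"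
      by (simp add: abs_mult power_abs mult_left_mono)
  qed (use assms in auto)
  then show ?thesis by simp
qed

lemma norm_lane_emden_field_le:
  assumes "0 < a" "a \<le> t" "\<bar>fst x\<bar> \<le> R" "\<bar>snd x\<bar> \<le> R"
  shows "norm (lane_emden_field n t x) \<le> R + R ^ n + 2 / a * R"
proof -
  have "norm (lane_emden_field n t x) \<le> \<bar>snd x\<bar> + \<bar>- (fst x ^ n) - 2 / t * snd x\<bar>"
    using norm_Pair_le[of "snd x" "- (fst x ^ n) - 2 / t * snd x"] by (simp add: lane_emden_field_def)
  also have "\<dots> \<le> \<bar>snd x\<bar> + (\<bar>fst x\<bar> ^ n + \<bar>2 / t * snd x\<bar>)"
    unfolding power_abs[symmetric] by linarith
  also have "\<dots> = \<bar>snd x\<bar> + (\<bar>fst x\<bar> ^ n + 2 / t * \<bar>snd x\<bar>)"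
    using assms by (simp add: abs_mult)
  also have "\<dots> \<le> R + (R ^ n + 2 / a * R)"
    using assms by (intro add_mono power_mono mult_mono divide_left_mono) auto
  finally show ?thesis by simp
qed

text \<open>The field is linear in the velocity with coefficient at most \<open>2 / a\<close> in
  size, so only the positions have to be bounded.\<close>

lemma lane_emden_field_lipschitz:
  assumes "0 < a" "a \<le> t" "\<bar>fst x\<bar> \<le> R" "\<bar>fst y\<bar> \<le> R"
  shows "norm (lane_emden_field n t x - lane_emden_field n t y)
           \<le> (1 + real n * R ^ (n - 1) + 2 / a) * norm (x - y)"
proof -
  let ?u = "\<bar>fst x - fst y\<bar>" and ?v = "\<bar>snd x - snd y\<bar>"
  have uv: "?u \<le> norm (x - y)" "?v \<le> norm (x - y)"
    using norm_fst_le[of "fst x - fst y" "snd x - snd y"] norm_snd_le[of "snd x - snd y" "fst x - fst y"]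
    by (auto simp: minus_prod_def)
  have "norm (lane_emden_field n t x - lane_emden_field n t y)
      \<le> ?v + \<bar>- (fst x ^ n) - 2 / t * snd x - (- (fst y ^ n) - 2 / t * snd y)\<bar>"
    using norm_Pair_le[of "snd x - snd y" "- (fst x ^ n) - 2 / t * snd x - (- (fst y ^ n) - 2 / t * snd y)"]
    by (simp add: lane_emden_field_def)
  also have "\<dots> = ?v + \<bar>(fst x ^ n - fst y ^ n) + 2 / t * (snd x - snd y)\<bar>"
    by (subst abs_minus_cancel[symmetric]) (simp add: algebra_simps diff_divide_distrib)
  also have "\<dots> \<le> ?v + (\<bar>fst x ^ n - fst y ^ n\<bar> + \<bar>2 / t * (snd x - snd y)\<bar>)"
    by (intro add_left_mono abs_triangle_ineq)
  also have "\<dots> \<le> ?v + (real n * R ^ (n - 1) * ?u + 2 / a * ?v)"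
  proof (intro add_left_mono add_mono power_diff_le)
    have "\<bar>2 / t * (snd x - snd y)\<bar> = 2 / t * ?v"
      using assms by (simp only: abs_mult) simp
    also have "\<dots> \<le> 2 / a * ?v"
      using assms by (intro mult_right_mono divide_left_mono) auto
    finally show "\<bar>2 / t * (snd x - snd y)\<bar> \<le> 2 / a * ?v" .
  qed (use assms in auto)
  also have "\<dots> \<le> norm (x - y) + (real n * R ^ (n - 1) * norm (x - y) + 2 / a * norm (x - y))"
    using assms uv by (intro add_mono mult_left_mono) auto
  finally show ?thesis
    by (simp add: algebra_simps)
qed

lemma lane_emden_solutionD:
  assumes "lane_emden_solution n q I" "t \<in> I"
  shows "(q has_real_derivative deriv q t) (at t)"
    and "(deriv q has_real_derivative (- (q t ^ n) - 2 / t * deriv q t)) (at t)"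
    and "0 < t"
  using assms by (auto simp: lane_emden_solution_def)

lemma lane_emden_solution_imp_field:
  assumes "lane_emden_solution n q I" "t \<in> I"
  shows "((\<lambda>s. (q s, deriv q s)) has_vector_derivative lane_emden_field n t (q t, deriv q t)) (at t)"
  using lane_emden_solutionD[OF assms]
  by (auto simp: lane_emden_field_def has_real_derivative_iff_has_vector_derivative
      intro!: has_vector_derivative_Pair)

text \<open>The first component of the system identifies \<open>deriv\<close> of the position with
  the velocity on \<open>I\<close>. As \<open>I\<close> is open, the derivative of the velocity
  carries over to \<open>deriv\<close> of the position.\<close>

lemma field_imp_lane_emden_solution:
  assumes "open I" "is_interval I" "I \<noteq> {}" "I \<subseteq> {0<..}"
    and x: "\<And>t. t \<in> I \<Longrightarrow> (x has_vector_derivative lane_emden_field n t (x t)) (at t)"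
  shows "lane_emden_solution n (\<lambda>t. fst (x t)) I"
    and "\<And>t. t \<in> I \<Longrightarrow> deriv (\<lambda>t. fst (x t)) t = snd (x t)"
proof -
  have d: "((\<lambda>t. fst (x t)) has_real_derivative snd (x t)) (at t)"
    "((\<lambda>t. snd (x t)) has_real_derivative (- (fst (x t) ^ n) - 2 / t * snd (x t))) (at t)"
    if "t \<in> I" for t
    using bounded_linear.has_vector_derivative[OF bounded_linear_fst x[OF that]]
      bounded_linear.has_vector_derivative[OF bounded_linear_snd x[OF that]]
    by (simp_all add: lane_emden_field_def has_real_derivative_iff_has_vector_derivative)
  show eq: "deriv (\<lambda>t. fst (x t)) t = snd (x t)" if "t \<in> I" for t
    using d(1)[OF that] by (rule DERIV_imp_deriv)
  have "(deriv (\<lambda>t. fst (x t)) has_real_derivative (- (fst (x t) ^ n) - 2 / t * snd (x t))) (at t)"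
    if "t \<in> I" for t
    using has_field_derivative_transform_within_open[OF d(2)[OF that] \<open>open I\<close> that] eq by auto
  then show "lane_emden_solution n (\<lambda>t. fst (x t)) I"
    using assms d(1) eq by (simp add: lane_emden_solution_def)
qed

section \<open>Local existence, uniqueness and gluing of solutions\<close>

text \<open>The point is that one \<open>\<delta>\<close> serves all starting times
  \<open>s \<ge> a\<close> and all data bounded by \<open>K\<close>: the bounds on the field depend
  only on \<open>a\<close>, \<open>K\<close> and \<open>n\<close>.\<close>

lemma lane_emden_local_existence:
  assumes "0 < a"
  obtains \<delta> where "0 < \<delta>"
    "\<And>s q0 q1. a \<le> s \<Longrightarrow> \<bar>q0\<bar> \<le> K \<Longrightarrow> \<bar>q1\<bar> \<le> K \<Longrightarrow>
       \<exists>p. lane_emden_solution n p {s - \<delta><..<s + \<delta>} \<and> p s = q0 \<and> deriv p s = q1"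
proof -
  \<comment> \<open>\<open>R\<close> bounds both components on the unit ball around the data.
    \<open>B\<close> and \<open>L\<close> bound the field and its Lipschitz constant there for times
    from \<open>a / 2\<close> on.\<close>
  define R where "R = \<bar>K\<bar> + 1"
  define B where "B = R + R ^ n + 2 / (a / 2) * R"
  define L where "L = 1 + real n * R ^ (n - 1) + 2 / (a / 2)"
  \<comment> \<open>The three entries keep times above \<open>a / 2\<close>, keep the iteration in
    the ball of radius 1, and leave \<open>\<delta> * L\<close> strictly below 1.\<close>
  define \<delta> where "\<delta> = Min {a / 2, 1 / B, 1 / (2 * L)}"
  have "R > 0" by (simp add: R_def)
  then have "B > 0" "L > 0"
    using assms by (auto simp: B_def L_def intro!: add_pos_nonneg)
  have "0 < \<delta>"
    using assms \<open>B > 0\<close> \<open>L > 0\<close> by (simp add: \<delta>_def)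
  have le: "\<delta> \<le> a / 2" "\<delta> \<le> 1 / B" "\<delta> \<le> 1 / (2 * L)"
    by (simp_all add: \<delta>_def)
  then have small: "\<delta> * B \<le> 1" "\<delta> * L < 1"
    using \<open>B > 0\<close> \<open>L > 0\<close> by (auto simp: field_simps)
  show thesis
  proof (rule that[OF \<open>0 < \<delta>\<close>])
    fix s q0 q1 assume s: "a \<le> s" and q: "\<bar>q0\<bar> \<le> K" "\<bar>q1\<bar> \<le> K"
    let ?J = "{s - \<delta><..<s + \<delta>}"
    have ge: "a / 2 \<le> t" if "t \<in> {s - \<delta>..s + \<delta>}" for t
      using that le s by auto
    have R: "\<bar>fst x\<bar> \<le> R \<and> \<bar>snd x\<bar> \<le> R" if "x \<in> cball (q0, q1) 1" for x
      using that q norm_fst_le[of "q0 - fst x" "q1 - snd x"] norm_snd_le[of "q1 - snd x" "q0 - fst x"]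
      by (cases x) (auto simp: dist_norm R_def)
    obtain x where x: "x s = (q0, q1)"
      "\<And>t. t \<in> ?J \<Longrightarrow> (x has_vector_derivative lane_emden_field n t (x t)) (at t)"
    proof (rule Picard_Lindeloef[OF \<open>0 < \<delta>\<close>, of L s "(q0, q1)" 1 "lane_emden_field n" B])
      show "continuous_on ({s - \<delta>..s + \<delta>} \<times> cball (q0, q1) 1) (\<lambda>(t, x). lane_emden_field n t x)"
        unfolding lane_emden_field_def case_prod_beta
        using ge assms by (intro continuous_intros) force
      show "norm (lane_emden_field n t x) \<le> B"
        if "t \<in> {s - \<delta>..s + \<delta>}" "x \<in> cball (q0, q1) 1" for t x
        unfolding B_def using assms ge[OF that(1)] R[OF that(2)]
        by (intro norm_lane_emden_field_le) auto
      show "norm (lane_emden_field n t x - lane_emden_field n t y) \<le> L * norm (x - y)"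
        if "t \<in> {s - \<delta>..s + \<delta>}" "x \<in> cball (q0, q1) 1" "y \<in> cball (q0, q1) 1" for t x y
        unfolding L_def using assms ge[OF that(1)] R[OF that(2)] R[OF that(3)]
        by (intro lane_emden_field_lipschitz) auto
    qed (use small \<open>B > 0\<close> \<open>L > 0\<close> in auto)
    have J: "open ?J" "is_interval ?J" "?J \<noteq> {}" "?J \<subseteq> {0<..}" "s \<in> ?J"
      using \<open>0 < \<delta>\<close> le s assms by (auto simp: is_interval_1)
    show "\<exists>p. lane_emden_solution n p ?J \<and> p s = q0 \<and> deriv p s = q1"
      using field_imp_lane_emden_solution[OF J(1-4) x(2)] x(1) J(5) by (intro exI[of _ "\<lambda>t. fst (x t)"]) auto
  qed
qed

text \<open>The segment between \<open>s\<close> and \<open>t\<close> lies in both intervals and is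
  compact and away from 0. Both positions are therefore bounded on it, which yields a Lipschitz
  constant along the two solutions.\<close>

lemma lane_emden_unique:
  assumes p: "lane_emden_solution n p J" and q: "lane_emden_solution n q I"
    and s: "s \<in> I \<inter> J" "p s = q s" "deriv p s = deriv q s" and t: "t \<in> I \<inter> J"
  shows "p t = q t"
proof -
  let ?a = "min s t" and ?b = "max s t"
  have K: "u \<in> I" "u \<in> J" "0 < ?a" if "u \<in> {?a..?b}" for u
    using s(1) t that p q mem_is_interval_1_I[of I ?a ?b u] mem_is_interval_1_I[of J ?a ?b u]
    by (auto simp: lane_emden_solution_def min_def max_def split: if_splits)
  have "continuous_on {?a..?b} p" "continuous_on {?a..?b} q"
    using K lane_emden_solutionD(1)[OF p] lane_emden_solutionD(1)[OF q]
    by (meson DERIV_isCont continuous_at_imp_continuous_on)+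
  then have "bounded (p ` {?a..?b} \<union> q ` {?a..?b})"
    by (simp add: compact_continuous_image compact_imp_bounded)
  then obtain R where R: "\<And>z. z \<in> p ` {?a..?b} \<union> q ` {?a..?b} \<Longrightarrow> \<bar>z\<bar> \<le> R"
    unfolding bounded_iff real_norm_def by blast
  have "(p t, deriv p t) = (q t, deriv q t)"
  proof (rule ode_unique[where x = "\<lambda>t. (p t, deriv p t)" and y = "\<lambda>t. (q t, deriv q t)" and s = s
        and a = ?a and b = ?b and f = "lane_emden_field n"
        and L = "1 + real n * R ^ (n - 1) + 2 / ?a"])
    fix u assume u: "u \<in> {?a..?b}"
    show "((\<lambda>t. (p t, deriv p t)) has_vector_derivative lane_emden_field n u (p u, deriv p u)) (at u)"
      using lane_emden_solution_imp_field[OF p K(2)[OF u]] .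
    show "((\<lambda>t. (q t, deriv q t)) has_vector_derivative lane_emden_field n u (q u, deriv q u)) (at u)"
      using lane_emden_solution_imp_field[OF q K(1)[OF u]] .
    show "norm (lane_emden_field n u (p u, deriv p u) - lane_emden_field n u (q u, deriv q u))
        \<le> (1 + real n * R ^ (n - 1) + 2 / ?a) * norm ((p u, deriv p u) - (q u, deriv q u))"
      using K(3)[OF u] R u by (intro lane_emden_field_lipschitz) auto
  qed (use s in auto)
  then show ?thesis by simp
qed

text \<open>Derivatives on the open set \<open>I\<close> see only the values in \<open>I\<close>.
  This allows a solution to be redefined outside its interval, as gluing requires.\<close>

lemma lane_emden_solution_cong:
  assumes q: "lane_emden_solution n q I" and eq: "\<And>t. t \<in> I \<Longrightarrow> r t = q t"
  shows "lane_emden_solution n r I"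
proof -
  have "open I"
    using q by (simp add: lane_emden_solution_def)
  have r: "(r has_real_derivative deriv q t) (at t)" if "t \<in> I" for t
    using has_field_derivative_transform_within_open[OF lane_emden_solutionD(1)[OF q that] \<open>open I\<close> that]
      eq by metis
  then have dr: "deriv r t = deriv q t" if "t \<in> I" for t
    using that by (metis DERIV_imp_deriv)
  have "(deriv r has_real_derivative (- (q t ^ n) - 2 / t * deriv q t)) (at t)" if "t \<in> I" for t
    using has_field_derivative_transform_within_open[OF lane_emden_solutionD(2)[OF q that] \<open>open I\<close> that]
      dr by metis
  then show ?thesis
    using q r dr eq by (simp add: lane_emden_solution_def)
qed

text \<open>By uniqueness the two solutions agree on the overlap, so they glue to a solution on
  \<open>I \<union> J\<close>; maximality forces this union to be \<open>I\<close>.\<close>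

lemma lane_emden_maximal_superset:
  assumes q: "maximal_lane_emden_solution n q I" and p: "lane_emden_solution n p J"
    and s: "s \<in> I \<inter> J" "p s = q s" "deriv p s = deriv q s"
  shows "J \<subseteq> I"
proof -
  have q': "lane_emden_solution n q I"
    using q by (simp add: maximal_lane_emden_solution_def)
  define r where "r = (\<lambda>t. if t \<in> I then q t else p t)"
  have "lane_emden_solution n r I"
    by (rule lane_emden_solution_cong[OF q']) (simp add: r_def)
  moreover have "lane_emden_solution n r J"
    using lane_emden_unique[OF p q' s] by (intro lane_emden_solution_cong[OF p]) (auto simp: r_def)
  ultimately have "lane_emden_solution n r (I \<union> J)"
    using s(1) unfolding lane_emden_solution_def is_interval_connected_1
    by (auto intro!: connected_Un)
  moreover have "\<forall>t\<in>I. r t = q t"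
    by (simp add: r_def)
  ultimately have "I \<union> J = I"
    using q unfolding maximal_lane_emden_solution_def by blast
  then show ?thesis by blast
qed

section \<open>Energy and a priori bounds\<close>

text \<open>Kinetic plus potential energy of the undamped oscillator
  \<open>q'' = - q ^ n\<close>.\<close>

definition lane_emden_energy :: "nat \<Rightarrow> (real \<Rightarrow> real) \<Rightarrow> real \<Rightarrow> real" where
  "lane_emden_energy n q t = (deriv q t)\<^sup>2 / 2 + q t ^ (n + 1) / (real n + 1)"

text \<open>The force terms cancel, so only the damping changes the energy.\<close>

lemma lane_emden_energy_deriv:
  assumes "lane_emden_solution n q I" "t \<in> I"
  shows "(lane_emden_energy n q has_real_derivative - 2 / t * (deriv q t)\<^sup>2) (at t)"
proof -
  note d = lane_emden_solutionD[OF assms]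
  have "((\<lambda>t. q t ^ (n + 1) / (real n + 1)) has_real_derivative q t ^ n * deriv q t) (at t)"
    using DERIV_cdivide[OF DERIV_power[OF d(1), of "n + 1"], of "real n + 1"]
    by (simp add: add.commute mult.commute del: power_Suc)
  moreover have "((\<lambda>t. (deriv q t)\<^sup>2 / 2) has_real_derivative
      deriv q t * (- (q t ^ n) - 2 / t * deriv q t)) (at t)"
    using DERIV_cdivide[OF DERIV_power[OF d(2), of 2], of 2]
    by (simp add: mult.commute)
  ultimately have "((\<lambda>t. (deriv q t)\<^sup>2 / 2 + q t ^ (n + 1) / (real n + 1)) has_real_derivative
      deriv q t * (- (q t ^ n) - 2 / t * deriv q t) + q t ^ n * deriv q t) (at t)"
    by (intro DERIV_add)
  then show ?thesis
    by (simp add: lane_emden_energy_def[abs_def] algebra_simps power2_eq_square)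
qed

text \<open>Oddness of \<open>n\<close> makes the potential energy nonnegative, so that the energy
  controls position and velocity separately.\<close>

lemma even_power_div_nonneg:
  assumes "odd n"
  shows "0 \<le> (x::real) ^ (n + 1) / (real n + 1)"
  using assms by (auto simp del: power_Suc intro!: divide_nonneg_nonneg zero_le_even_power)

text \<open>The factor adds up two cases: forward in time the energy decreases, giving 1; backward
  in time \<open>t ^ 4\<close> times the energy is monotone, giving \<open>(s / t) ^ 4\<close>. The
  exponent 4 comes from the energy losing at most \<open>4 / t\<close> times itself per unit
  time.\<close>

lemma lane_emden_energy_le:
  assumes "odd n" and q: "lane_emden_solution n q I" and s: "s \<in> I" and t: "t \<in> I"
  shows "lane_emden_energy n q t \<le> lane_emden_energy n q s * (1 + (s / t) ^ 4)"
proof -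
  let ?E = "lane_emden_energy n q"
  have I: "is_interval I"
    using q by (simp add: lane_emden_solution_def)
  have ge: "(deriv q u)\<^sup>2 / 2 \<le> ?E u" for u
    using even_power_div_nonneg[OF \<open>odd n\<close>, of "q u"] by (simp add: lane_emden_energy_def)
  have nn: "0 \<le> ?E u" for u
    by (rule order_trans[OF _ ge]) simp
  have pos: "0 < s" "0 < t"
    using lane_emden_solutionD(3)[OF q] s t by auto
  show ?thesis
  proof (cases "s \<le> t")
    case True
    have "?E t \<le> ?E s"
    proof (rule DERIV_nonpos_imp_nonincreasing[OF True])
      fix u assume "s \<le> u" "u \<le> t"
      then have u: "u \<in> I"
        using mem_is_interval_1_I[OF I s t] by blast
      have "- 2 / u * (deriv q u)\<^sup>2 \<le> 0"
        using lane_emden_solutionD(3)[OF q u] by (intro mult_nonpos_nonneg) auto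
      then show "\<exists>y. (?E has_real_derivative y) (at u) \<and> y \<le> 0"
        using lane_emden_energy_deriv[OF q u] by blast
    qed
    also have "\<dots> \<le> ?E s * (1 + (s / t) ^ 4)"
      using nn[of s] by (simp add: algebra_simps)
    finally show ?thesis .
  next
    case False
    then have "t \<le> s" by simp
    have "t ^ 4 * ?E t \<le> s ^ 4 * ?E s"
    proof (rule DERIV_nonneg_imp_nondecreasing[OF \<open>t \<le> s\<close>])
      fix u assume "t \<le> u" "u \<le> s"
      then have u: "u \<in> I"
        using mem_is_interval_1_I[OF I t s] by blast
      have "u > 0"
        using lane_emden_solutionD(3)[OF q u] .
      \<comment> \<open>The bracket is the potential energy: the power 4 is just enough to cancel
        the kinetic part.\<close>
      have "((\<lambda>u. u ^ 4 * ?E u) has_real_derivative 4 * u ^ 3 * (?E u - (deriv q u)\<^sup>2 / 2)) (at u)"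
        using lane_emden_energy_deriv[OF q u] \<open>u > 0\<close>
        by (auto intro!: derivative_eq_intros simp: field_simps eval_nat_numeral)
      moreover have "0 \<le> 4 * u ^ 3 * (?E u - (deriv q u)\<^sup>2 / 2)"
        using \<open>u > 0\<close> ge[of u] by (intro mult_nonneg_nonneg) auto
      ultimately show "\<exists>y. ((\<lambda>u. u ^ 4 * ?E u) has_real_derivative y) (at u) \<and> 0 \<le> y"
        by blast
    qed
    then have "?E t \<le> ?E s * (s / t) ^ 4"
      using pos by (simp add: field_simps)
    also have "\<dots> \<le> ?E s * (1 + (s / t) ^ 4)"
      using nn[of s] by (intro mult_left_mono) auto
    finally show ?thesis .
  qed
qed

lemma lane_emden_bounded:
  assumes "odd n" and q: "lane_emden_solution n q I" and "0 < a"
  obtains K where "\<And>t. t \<in> I \<Longrightarrow> a \<le> t \<Longrightarrow> \<bar>q t\<bar> \<le> K \<and> \<bar>deriv q t\<bar> \<le> K"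
proof -
  let ?E = "lane_emden_energy n q"
  obtain s where s: "s \<in> I"
    using q by (auto simp: lane_emden_solution_def)
  define M where "M = ?E s * (1 + (s / a) ^ 4)"
  show thesis
  proof (rule that[of "1 + (real n + 1) * M"])
    fix t assume t: "t \<in> I" "a \<le> t"
    have "0 < s"
      using lane_emden_solutionD(3)[OF q s] .
    have Es: "0 \<le> ?E s"
      using even_power_div_nonneg[OF \<open>odd n\<close>, of "q s"] by (simp add: lane_emden_energy_def)
    have "?E t \<le> ?E s * (1 + (s / t) ^ 4)"
      by (rule lane_emden_energy_le[OF \<open>odd n\<close> q s t(1)])
    also have "\<dots> \<le> M"
      unfolding M_def using Es \<open>0 < a\<close> \<open>0 < s\<close> t(2)
      by (intro mult_left_mono add_left_mono power_mono divide_left_mono) auto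
    finally have "?E t \<le> M" .
    moreover have "0 \<le> q t ^ (n + 1) / (real n + 1)"
      by (rule even_power_div_nonneg[OF \<open>odd n\<close>])
    ultimately have v: "(deriv q t)\<^sup>2 / 2 \<le> M" and w: "q t ^ (n + 1) / (real n + 1) \<le> M"
      unfolding lane_emden_energy_def using zero_le_power2[of "deriv q t"] by linarith+
    have "0 \<le> M"
      by (rule order_trans[OF _ v]) simp
    \<comment> \<open>This estimate replaces taking roots: one constant then bounds both the
      position, with exponent \<open>n + 1\<close>, and the velocity, with exponent 2.\<close>
    have self_le: "\<bar>x\<bar> \<le> 1 + \<bar>x\<bar> ^ Suc m" for x :: real and m
      using self_le_power[of "\<bar>x\<bar>" "Suc m"] by (cases "1 \<le> \<bar>x\<bar>") (auto simp del: power_Suc simp: add_increasing2)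
    have "\<bar>q t\<bar> ^ Suc n = q t ^ (n + 1)"
      using \<open>odd n\<close> by (simp add: power_even_abs del: power_Suc)
    also have "\<dots> \<le> (real n + 1) * M"
      using w by (simp add: field_simps)
    finally have "\<bar>q t\<bar> \<le> 1 + (real n + 1) * M"
      using self_le[of "q t" n] by linarith
    moreover have "\<bar>deriv q t\<bar> \<le> 1 + (real n + 1) * M"
    proof -
      have "1 \<le> n"
        using \<open>odd n\<close> by (cases n) auto
      then have "2 * M \<le> (real n + 1) * M"
        using \<open>0 \<le> M\<close> by (intro mult_right_mono) auto
      then show ?thesis
        using self_le[of "deriv q t" 1] v by (simp add: power2_eq_square)
    qed
    ultimately show "\<bar>q t\<bar> \<le> 1 + (real n + 1) * M \<and> \<bar>deriv q t\<bar> \<le> 1 + (real n + 1) * M" ..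
  qed
qed

section \<open>Global existence\<close>

text \<open>The half-line is connected and \<open>I\<close> is open and nonempty, so it suffices
  that \<open>I\<close> contains every positive point of its closure.\<close>

lemma lane_emden_global:
  assumes "odd n" and max: "maximal_lane_emden_solution n q I"
  shows "I = {0<..}"
proof -
  have q: "lane_emden_solution n q I"
    using max by (simp add: maximal_lane_emden_solution_def)
  then have I: "open I" "I \<noteq> {}" "I \<subseteq> {0<..}"
    by (auto simp: lane_emden_solution_def)
  have "x \<in> I" if x: "0 < x" "x \<in> closure I" for x
  proof -
    have "0 < x / 2"
      using x by simp
    obtain K where K: "\<And>t. t \<in> I \<Longrightarrow> x / 2 \<le> t \<Longrightarrow> \<bar>q t\<bar> \<le> K \<and> \<bar>deriv q t\<bar> \<le> K"
      using lane_emden_bounded[OF \<open>odd n\<close> q \<open>0 < x / 2\<close>] by blast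
    obtain \<delta> where "0 < \<delta>" and ex: "\<And>s q0 q1. x / 2 \<le> s \<Longrightarrow> \<bar>q0\<bar> \<le> K \<Longrightarrow> \<bar>q1\<bar> \<le> K \<Longrightarrow>
       \<exists>p. lane_emden_solution n p {s - \<delta><..<s + \<delta>} \<and> p s = q0 \<and> deriv p s = q1"
      using lane_emden_local_existence[OF \<open>0 < x / 2\<close>] by metis
    \<comment> \<open>\<open>\<delta>\<close> is fixed before \<open>s\<close> is chosen. Distance
      below \<open>x / 2\<close> puts \<open>s\<close> where \<open>K\<close> is a valid bound;
      distance below \<open>\<delta>\<close> lets the solution restarted at \<open>s\<close> reach
      \<open>x\<close>.\<close>
    obtain s where s: "s \<in> I" "dist s x < min \<delta> (x / 2)"
      using x \<open>0 < \<delta>\<close> unfolding closure_approachable by (metis \<open>0 < x / 2\<close> min_less_iff_conj)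
    then have "x / 2 \<le> s" and near: "x \<in> {s - \<delta><..<s + \<delta>}" "s \<in> {s - \<delta><..<s + \<delta>}"
      using \<open>0 < \<delta>\<close> unfolding dist_real_def min_less_iff_conj greaterThanLessThan_iff by linarith+
    then obtain p where p: "lane_emden_solution n p {s - \<delta><..<s + \<delta>}" "p s = q s" "deriv p s = deriv q s"
      using ex K[OF s(1)] by blast
    then have "{s - \<delta><..<s + \<delta>} \<subseteq> I"
      using s(1) near by (intro lane_emden_maximal_superset[OF max p(1) _ p(2,3)]) auto
    then show ?thesis
      using near by blast
  qed
  then have "I = {0<..} \<inter> closure I"
    using I(3) closure_subset[of I] by auto
  then have "closedin (top_of_set {0<..}) I"
    using closed_closure unfolding closedin_closed by blast
  moreover have "openin (top_of_set {0<..}) I"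
    using I by (intro open_subset)
  ultimately show ?thesis
    using I(2) connected_Ioi[of "0::real"] unfolding connected_clopen by blast
qed

section \<open>Decay at infinity\<close>

text \<open>Both summands are nonnegative, so each is at most \<open>C\<close>: the kinetic one
  gives the rate of the velocity and the potential one that of the position. The constant obtained
  is \<open>G 1\<close>.\<close>

lemma lane_emden_decay:
  assumes "odd n" and q: "lane_emden_solution n q {0<..}"
  obtains C where "\<And>t. 1 \<le> t \<Longrightarrow> t / 4 * (deriv q t)\<^sup>2 + t * (q t ^ (n + 1) / (real n + 1)) \<le> C"
proof -
  \<comment> \<open>Any coefficient $a \in [1/(n+1), 3/2]$ of $q\dot q + q^2/t$ makes $G$ nonincreasing.\<close>
  define G where "G = (\<lambda>t. t * lane_emden_energy n q t + q t * deriv q t + (q t)\<^sup>2 / t)"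
  have "t / 4 * (deriv q t)\<^sup>2 + t * (q t ^ (n + 1) / (real n + 1)) \<le> G 1" if "1 \<le> t" for t
  proof -
    \<comment> \<open>This square absorbs the mixed term of \<open>G\<close> and all of
      \<open>(q t)\<^sup>2 / t\<close>, at the price of half the kinetic energy.\<close>
    have "(t * deriv q t + 2 * q t)\<^sup>2 / (4 * t)
        = t / 4 * (deriv q t)\<^sup>2 + q t * deriv q t + (q t)\<^sup>2 / t"
      using that by (simp add: power2_eq_square field_simps)
    then have "t / 4 * (deriv q t)\<^sup>2 + t * (q t ^ (n + 1) / (real n + 1))
        = G t - (t * deriv q t + 2 * q t)\<^sup>2 / (4 * t)"
      by (simp add: G_def lane_emden_energy_def distrib_left)
    also have "\<dots> \<le> G t"
      using that by simp
    also have "G t \<le> G 1"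
    proof (rule DERIV_nonpos_imp_nonincreasing[OF that])
      fix u :: real assume "1 \<le> u"
      then have u: "u \<in> {0<..}" "u \<noteq> 0" by auto
      note d = lane_emden_solutionD(1,2)[OF q u(1)] lane_emden_energy_deriv[OF q u(1)]
      \<comment> \<open>The term \<open>(q t)\<^sup>2 / t\<close> in \<open>G\<close> is there to
        cancel the mixed term that the damping produces in the derivative of
        \<open>q t * deriv q t\<close>.\<close>
      have "(G has_real_derivative
          lane_emden_energy n q u - q u ^ (n + 1) - (deriv q u)\<^sup>2 - (q u)\<^sup>2 / u\<^sup>2) (at u)"
        unfolding G_def using u
        by (auto intro!: derivative_eq_intros d simp: field_simps power2_eq_square)
      moreover have "q u ^ (n + 1) / (real n + 1) \<le> q u ^ (n + 1)"
        using \<open>odd n\<close> zero_le_even_power[of "n + 1" "q u"]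
        by (simp add: divide_le_eq mult_left_le algebra_simps del: power_Suc)
      then have "lane_emden_energy n q u - q u ^ (n + 1) - (deriv q u)\<^sup>2 - (q u)\<^sup>2 / u\<^sup>2 \<le> 0"
        unfolding lane_emden_energy_def
        using zero_le_power2[of "deriv q u"]
          divide_nonneg_nonneg[OF zero_le_power2[of "q u"] zero_le_power2[of u]] by linarith
      ultimately show "\<exists>y. (G has_real_derivative y) (at u) \<and> y \<le> 0"
        by blast
    qed
    finally show ?thesis .
  qed
  then show thesis
    by (rule that)
qed

theorem theorem3:
  fixes n :: nat
  assumes "odd n"
  shows "(\<forall>q I. maximal_lane_emden_solution n q I \<longrightarrow> I = {0<..}) \<and>
         (n \<ge> 5 \<longrightarrow>
           (\<forall>q I. maximal_lane_emden_solution n q I \<longrightarrow>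
             (\<exists>c3 c4 :: real. \<forall>\<^sub>F t in at_top.
                \<bar>q t\<bar> \<le> c3 / t powr (1 / (real n + 1)) \<and> \<bar>deriv q t\<bar> \<le> c4 / sqrt t)))"
proof (intro conjI impI allI)
  fix q I assume max: "maximal_lane_emden_solution n q I"
  show I: "I = {0<..}"
    by (rule lane_emden_global[OF assms max])
next
  fix q I assume max: "maximal_lane_emden_solution n q I"
  then have "lane_emden_solution n q {0<..}"
    using lane_emden_global[OF assms max] by (simp add: maximal_lane_emden_solution_def)
  then obtain C where
    C: "\<And>t. 1 \<le> t \<Longrightarrow> t / 4 * (deriv q t)\<^sup>2 + t * (q t ^ (n + 1) / (real n + 1)) \<le> C"
    using lane_emden_decay[OF assms] by blast
  define N where "N = n + 1"
  have bound: "\<bar>q t\<bar> \<le> root N (real N * C) / t powr (1 / (real n + 1)) \<and>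
      \<bar>deriv q t\<bar> \<le> sqrt (4 * C) / sqrt t" if t: "1 \<le> t" for t
  proof
    have pot: "0 \<le> t * (q t ^ (n + 1) / (real n + 1))"
      using t even_power_div_nonneg[OF assms] by (intro mult_nonneg_nonneg) auto
    have kin: "0 \<le> t / 4 * (deriv q t)\<^sup>2"
      using t by simp
    have "t * (q t ^ (n + 1) / (real n + 1)) \<le> C"
      using C[OF t] kin by linarith
    then have "q t ^ N \<le> real N * C / t"
      using t by (simp add: N_def field_simps)
    then have "\<bar>q t\<bar> ^ N \<le> real N * C / t"
      using assms by (simp add: N_def power_even_abs del: power_Suc)
    \<comment> \<open>\<open>N\<close> is positive, so \<open>root N\<close> is monotone; applied to
      the power of the absolute value it returns the absolute value itself.\<close>
    then have "root N (\<bar>q t\<bar> ^ N) \<le> root N (real N * C / t)"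
      by (intro real_root_le_mono) (auto simp: N_def)
    then show "\<bar>q t\<bar> \<le> root N (real N * C) / t powr (1 / (real n + 1))"
      using t root_powr_inverse[of N t]
      by (simp add: N_def real_root_power_cancel real_root_divide add.commute del: power_Suc)
    have "t / 4 * (deriv q t)\<^sup>2 \<le> C"
      using C[OF t] pot by linarith
    then have "(deriv q t)\<^sup>2 \<le> 4 * C / t"
      using t by (simp add: field_simps)
    then show "\<bar>deriv q t\<bar> \<le> sqrt (4 * C) / sqrt t"
      using real_sqrt_le_mono by (fastforce simp: real_sqrt_divide)
  qed
  show "\<exists>c3 c4. \<forall>\<^sub>F t in at_top.
      \<bar>q t\<bar> \<le> c3 / t powr (1 / (real n + 1)) \<and> \<bar>deriv q t\<bar> \<le> c4 / sqrt t"
    using eventually_mono[OF eventually_ge_at_top[of "1::real"], of "\<lambda>t. \<bar>q t\<bar> \<le>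
      root N (real N * C) / t powr (1 / (real n + 1)) \<and> \<bar>deriv q t\<bar> \<le> sqrt (4 * C) / sqrt t"] bound
    by blast
qed

end
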